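(* For any real $x>0$ and $\varepsilon>0$, \[ \pi(H_3^r) \geq \frac{F(x)-\varepsilon-o(1)}{r^2} \quad\text{as } r\to\infty, \] i.e. $\liminf_{r\to\infty} r^2\pi(H_3^r)\ge F(x)-\varepsilon$, where \[ F(x)=\frac{2xe^{-x}}{1-e^{-2x}} + 2x\sum_{i=1}^{\infty}2^{-i}\exp(-2^{-i}x) - 4x^2\sum_{i=1}^{\infty}2^{-2i}\exp(-2^{1-i}x). \]
   Context: $H_3^r$ is the $r$-uniform hypergraph with $r+1$ vertices and $3$ edges; ${\rm ex}(n,H)$ is the maximum number of edges in an $r$-uniform hypergraph on $n$ vertices with no subgraph isomorphic to $H$; $\pi(H)=\lim_{n\to\infty}{\rm ex}(n,H)/\binom{n}{r}$. *)

theory Defs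
  imports Complex_Main "HOL-Library.Extended_Real"
begin

type_synonym 'a hypergraph = "'a set \<times> 'a set set"

abbreviation verts :: "'a hypergraph \<Rightarrow> 'a set" where "verts \<equiv> fst"
abbreviation edges :: "'a hypergraph \<Rightarrow> 'a set set" where "edges \<equiv> snd"

definition uniform_hypergraph :: "nat \<Rightarrow> 'a hypergraph \<Rightarrow> bool" where
  "uniform_hypergraph r G \<longleftrightarrow>
     finite (verts G) \<and> (\<forall>e\<in>edges G. e \<subseteq> verts G \<and> card e = r)"

text \<open>Subgraphs are not required to be induced or spanning.\<close>

definition subhypergraph :: "'a hypergraph \<Rightarrow> 'a hypergraph \<Rightarrow> bool" where
  "subhypergraph G' G \<longleftrightarrow>
     verts G' \<subseteq> verts G \<and> edges G' \<subseteq> edges G \<and> (\<forall>e\<in>edges G'. e \<subseteq> verts G')"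

definition hypergraph_iso :: "'a hypergraph \<Rightarrow> 'b hypergraph \<Rightarrow> bool" where
  "hypergraph_iso G H \<longleftrightarrow>
     (\<exists>f. bij_betw f (verts G) (verts H) \<and> edges H = (\<lambda>e. f ` e) ` edges G)"

definition contains_copy :: "'a hypergraph \<Rightarrow> 'b hypergraph \<Rightarrow> bool" where
  "contains_copy G H \<longleftrightarrow> (\<exists>G'. subhypergraph G' G \<and> hypergraph_iso G' H)"

text \<open>Up to isomorphism the vertex set of a hypergraph on \<open>n\<close> vertices may be taken to be
  \<open>{..<n}\<close>. The set below is finite, and if \<open>H\<close> has an edge it contains \<open>0\<close>.\<close>

definition ex_num :: "nat \<Rightarrow> nat \<Rightarrow> 'b hypergraph \<Rightarrow> nat" where
  "ex_num r n H =
     Max {card (edges G) | G :: nat hypergraph.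
            uniform_hypergraph r G \<and> verts G = {..<n} \<and> \<not> contains_copy G H}"

definition turan_density :: "nat \<Rightarrow> 'b hypergraph \<Rightarrow> real" where
  "turan_density r H = lim (\<lambda>n. real (ex_num r n H) / real (n choose r))"

text \<open>For \<open>r \<ge> 2\<close> this is the only \<open>r\<close>-uniform hypergraph with \<open>r + 1\<close> vertices and three
  edges, up to isomorphism (\<open>H3_unique\<close>); for \<open>r < 2\<close> there is none.\<close>

definition H3 :: "nat \<Rightarrow> nat hypergraph" where
  "H3 r = ({..r}, (\<lambda>i. {..r} - {i}) ` {0, 1, 2})"

lemma H3_props:
  assumes "r \<ge> 2"
  shows "uniform_hypergraph r (H3 r)" "card (verts (H3 r)) = r + 1" "card (edges (H3 r)) = 3"
proof -
  show "uniform_hypergraph r (H3 r)" "card (verts (H3 r)) = r + 1"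
    using assms by (auto simp: uniform_hypergraph_def H3_def card_Diff_singleton_if)
  have "inj_on (\<lambda>i. {..r} - {i}) {0, 1, 2::nat}"
    using assms by (intro inj_onI) (force simp: set_eq_iff)
  from card_image[OF this] show "card (edges (H3 r)) = 3"
    by (simp add: H3_def)
qed

lemma H3_unique:
  fixes G :: "'a hypergraph"
  assumes r: "r \<ge> 2" and G: "uniform_hypergraph r G" "card (verts G) = r + 1" "card (edges G) = 3"
  shows "hypergraph_iso G (H3 r)"
proof -
  let ?V = "verts G"
  have fin: "finite ?V" using G(1) by (simp add: uniform_hypergraph_def)
  have ed: "\<exists>a\<in>?V. e = ?V - {a}" if "e \<in> edges G" for e
  proof -
    have e: "e \<subseteq> ?V" "card e = r" using that G(1) by (auto simp: uniform_hypergraph_def)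
    then have "card (?V - e) = 1"
      using G(2) fin by (simp add: card_Diff_subset finite_subset)
    then obtain a where "?V - e = {a}" by (auto simp: card_1_singleton_iff)
    then have "a \<in> ?V" "e = ?V - {a}" using e(1) by blast+
    then show ?thesis by blast
  qed
  obtain e1 e2 e3 where E: "edges G = {e1, e2, e3}" "e1 \<noteq> e2" "e1 \<noteq> e3" "e2 \<noteq> e3"
    using G(3) by (auto simp: card_3_iff)
  obtain a where a: "a \<in> ?V" "e1 = ?V - {a}" using ed[of e1] E(1) by blast
  obtain b where b: "b \<in> ?V" "e2 = ?V - {b}" using ed[of e2] E(1) by blast
  obtain c where c: "c \<in> ?V" "e3 = ?V - {c}" using ed[of e3] E(1) by blast
  have ne: "a \<noteq> b" "a \<noteq> c" "b \<noteq> c"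
    using E(2-4) unfolding a(2) b(2) c(2) by blast+
  have "card (?V - {a,b,c}) = card {3..r}"
    using a b c ne fin G(2) by (subst card_Diff_subset) auto
  then obtain g where g: "bij_betw g (?V - {a,b,c}) {3..r}"
    using finite_same_card_bij[of "?V - {a,b,c}" "{3..r}"] fin by auto
  define f where "f = (\<lambda>v. if v = a then 0 else if v = b then 1 else if v = c then 2 else g v)"
  have f: "f a = 0" "f b = 1" "f c = 2" using ne by (auto simp: f_def)
  have "bij_betw f (?V - {a,b,c}) {3..r}"
    using g by (rule bij_betw_cong[THEN iffD1, rotated]) (auto simp: f_def)
  moreover have "bij_betw f {a,b,c} {0,1,2}"
    using ne by (auto simp: bij_betw_def inj_on_def f)
  ultimately have "bij_betw f ((?V - {a,b,c}) \<union> {a,b,c}) ({3..r} \<union> {0,1,2})"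
    by (rule bij_betw_combine) auto
  moreover have "(?V - {a,b,c}) \<union> {a,b,c} = ?V" using a b c by blast
  moreover have "{3..r} \<union> {0,1,2} = {..r}" using r by auto
  ultimately have bij: "bij_betw f ?V {..r}" by simp
  have im: "f ` (?V - {v}) = {..r} - {f v}" if "v \<in> ?V" for v
    using bij that by (auto simp: bij_betw_def inj_on_def)
  have "edges (H3 r) = (\<lambda>e. f ` e) ` edges G"
    unfolding E(1) a(2) b(2) c(2) by (simp add: im a(1) b(1) c(1) f H3_def)
  with bij show ?thesis unfolding hypergraph_iso_def H3_def by auto
qed

text \<open>\<open>suminf\<close> starts at \<open>0\<close>, so the summation index is \<open>Suc j\<close>.\<close>

definition F :: "real \<Rightarrow> real" where
  "F x = 2 * x * exp (- x) / (1 - exp (- 2 * x))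
     + 2 * x * (\<Sum>j. let i = real (Suc j) in 2 powr (- i) * exp (- (2 powr (- i)) * x))
     - 4 * x\<^sup>2 * (\<Sum>j. let i = real (Suc j) in 2 powr (- 2 * i) * exp (- (2 powr (1 - i)) * x))"

end

theory Submission
  imports Defs "HOL-Library.FuncSet"
begin

text \<open>Label the vertices by numbers below \<open>N = 2 ^ k\<close>, and let an \<open>r\<close>-set be an edge if the exclusive or
  \<open>s\<close> of its labels is smaller than the exclusive or of any two of them. If \<open>\<sigma>\<close> is the exclusive or of the
  labels on an \<open>(r + 1)\<close>-set, then three edges, arising by deleting vertices with labels \<open>\<sigma> XOR a\<close>,
  \<open>\<sigma> XOR b\<close>, \<open>\<sigma> XOR c\<close>, would give \<open>a < b XOR c\<close>, \<open>b < a XOR c\<close> and \<open>c < a XOR b\<close>, which is impossible.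
  For random labels \<open>s\<close> is uniform, and by a birthday estimate all pairs are farther apart than \<open>s\<close> with
  probability about \<open>exp (- r\<^sup>2 * s / (2 * N))\<close>; averaging over \<open>s\<close> gives density about \<open>2 / r\<^sup>2\<close>.
  So the lower limit of \<open>r\<^sup>2 * turan_density r (H3 r)\<close> is at least \<open>2\<close>, and \<open>F x \<le> 2\<close> for all \<open>x > 0\<close>.\<close>

section \<open>Bitwise exclusive or\<close>

unbundle bit_operations_syntax

interpretation xor_sum: comm_monoid_set "xor :: nat \<Rightarrow> nat \<Rightarrow> nat" 0 ..

lemma xor_self_left: "a XOR (a XOR b) = (b::nat)"
  by (simp flip: xor.assoc)

lemma xor_div_2: "(a XOR b) div 2 = (a div 2) XOR (b div (2::nat))"
  by (simp add: bit_eq_iff bit_xor_iff flip: bit_Suc)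

text \<open>Truncation to \<open>k\<close> bits commutes with \<open>XOR\<close>. Closure of the
  label range under \<open>XOR\<close> is why the number of labels is a power of two.\<close>

lemma xor_less_power2:
  assumes "a < 2 ^ k" "b < (2::nat) ^ k"
  shows "a XOR b < 2 ^ k"
  using assms take_bit_xor[of k a b] by (simp add: take_bit_nat_eq_self_iff[symmetric])

text \<open>If the three strict inequalities held, the leading bit of \<open>q = a XOR b XOR c\<close> would be
  \<open>0\<close> in each of \<open>a\<close>, \<open>b\<close>, \<open>c\<close>, but \<open>1\<close> in \<open>q\<close>. The induction strips the last bit.\<close>

lemma xor_no_strict_triangle:
  fixes a b c :: nat
  shows "\<not> (a < b XOR c \<and> b < a XOR c \<and> c < a XOR b)"
proof (induction a arbitrary: b c rule: less_induct)
  case (less a)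
  show ?case
  proof (cases "a = 0")
    case True
    then show ?thesis by auto
  next
    case False
    define a' b' c' where "a' = a div 2" and "b' = b div 2" and "c' = c div 2"
    have IH: "\<not> (a' < b' XOR c' \<and> b' < a' XOR c' \<and> c' < a' XOR b')"
      using less[of a'] False by (simp add: a'_def)
    show ?thesis
    proof
      assume *: "a < b XOR c \<and> b < a XOR c \<and> c < a XOR b"
      then have le: "a' \<le> b' XOR c'" "b' \<le> a' XOR c'" "c' \<le> a' XOR b'"
        by (simp_all add: a'_def b'_def c'_def flip: xor_div_2) (simp_all add: div_le_mono)
      \<comment> \<open>Each equality says that \<open>a' XOR b' XOR c' = 0\<close>. So the three
        weak inequalities are all strict, which \<open>IH\<close> excludes, or all
        equalities.\<close>
      have eqs: "a' = b' XOR c' \<longleftrightarrow> b' = a' XOR c'" "a' = b' XOR c' \<longleftrightarrow> c' = a' XOR b'"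
        by (auto simp: xor_self_left ac_simps)
      have "a' = b' XOR c'" using IH le eqs by (auto simp: le_less)
      then have div: "a div 2 = (b XOR c) div 2" "b div 2 = (a XOR c) div 2" "c div 2 = (a XOR b) div 2"
        using eqs by (simp_all add: xor_div_2 a'_def b'_def c'_def)
      \<comment> \<open>Numbers with equal halves differ only in the last bit. Hence
        \<open>a\<close>, \<open>b\<close>, \<open>c\<close> would all be even while
        \<open>b XOR c\<close> is odd.\<close>
      have half: "even m \<and> odd n" if "m div 2 = n div 2" "m < n" for m n :: nat
        using that by presburger
      have "even a \<and> odd (b XOR c)" "even b \<and> odd (a XOR c)"  "even c \<and> odd (a XOR b)"
        using * div half by blast+
      then show False by (auto simp: even_xor_iff)
    qed
  qed
qed

section \<open>A construction without H3\<close>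

definition spread :: "('a \<Rightarrow> nat) \<Rightarrow> 'a set \<Rightarrow> bool" where
  "spread f e \<longleftrightarrow> (\<forall>a\<in>e. \<forall>b\<in>e. a \<noteq> b \<longrightarrow> xor_sum.F f e < f a XOR f b)"

lemma spread_cong: "(\<And>v. v \<in> e \<Longrightarrow> f v = g v) \<Longrightarrow> spread f e \<longleftrightarrow> spread g e"
  unfolding spread_def by (simp cong: xor_sum.cong)

text \<open>Deleting \<open>v\<close> changes the total from \<open>?\<sigma>\<close> to
  \<open>?\<sigma> XOR f v\<close>. Each of the three sets still contains the other two deleted
  vertices, and \<open>?\<sigma>\<close> cancels in pairwise \<open>XOR\<close>s, so the forbidden
  strict triangle appears.\<close>

lemma spread_deletions:
  assumes fin: "finite S" and abc: "a \<in> S" "b \<in> S" "c \<in> S" "a \<noteq> b" "a \<noteq> c" "b \<noteq> c"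
    and sp: "spread f (S - {a})" "spread f (S - {b})" "spread f (S - {c})"
  shows False
proof -
  let ?\<sigma> = "xor_sum.F f S"
  have del: "xor_sum.F f (S - {v}) = ?\<sigma> XOR f v" if "v \<in> S" for v
    using xor_sum.remove[OF fin that, of f] by (simp add: xor_self_left ac_simps)
  have x: "(?\<sigma> XOR f u) XOR (?\<sigma> XOR f v) = f u XOR f v" for u v
    by (metis xor.left_commute xor_self_left xor.assoc)
  have "?\<sigma> XOR f a < f b XOR f c" "?\<sigma> XOR f b < f a XOR f c" "?\<sigma> XOR f c < f a XOR f b"
    using sp abc unfolding spread_def by (auto simp: del)
  then show False
    using xor_no_strict_triangle[of "?\<sigma> XOR f a" "?\<sigma> XOR f b" "?\<sigma> XOR f c"] by (simp add: x)
qed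

definition spread_hypergraph :: "nat \<Rightarrow> 'a set \<Rightarrow> ('a \<Rightarrow> nat) \<Rightarrow> 'a hypergraph" where
  "spread_hypergraph r V f = (V, {e. e \<subseteq> V \<and> card e = r \<and> spread f e})"

lemma uniform_spread_hypergraph: "finite V \<Longrightarrow> uniform_hypergraph r (spread_hypergraph r V f)"
  by (auto simp: uniform_hypergraph_def spread_hypergraph_def)

lemma spread_hypergraph_H3_free:
  assumes "finite V" "r \<ge> 2"
  shows "\<not> contains_copy (spread_hypergraph r V f) (H3 r)"
proof
  assume "contains_copy (spread_hypergraph r V f) (H3 r)"
  then obtain G' g where G': "subhypergraph G' (spread_hypergraph r V f)"
    and g: "bij_betw g (verts G') {..r}" "edges (H3 r) = (\<lambda>e. g ` e) ` edges G'"
    unfolding contains_copy_def hypergraph_iso_def H3_def by auto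
  have fin: "finite (verts G')"
    using G' assms(1) by (auto simp: subhypergraph_def spread_hypergraph_def intro: finite_subset)
  have sub: "e \<subseteq> verts G'" "spread f e" if "e \<in> edges G'" for e
    using G' that by (auto simp: subhypergraph_def spread_hypergraph_def)
  \<comment> \<open>The preimages of 0, 1, 2 are the three vertices whose deletions are the edges of
    the copy.\<close>
  define v where "v i = inv_into (verts G') g i" for i
  have v: "v i \<in> verts G'" "g (v i) = i" if "i \<le> r" for i
    using that g(1) by (auto simp: v_def bij_betw_def f_inv_into_f inv_into_into)
  have sp: "spread f (verts G' - {v i})" if "i \<in> {0,1,2}" for i
  proof -
    have i: "i \<le> r" using that assms(2) by auto
    have "{..r} - {i} \<in> (\<lambda>e. g ` e) ` edges G'"
      unfolding g(2)[symmetric] using that by (auto simp: H3_def)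
    then obtain e where e: "e \<in> edges G'" "g ` e = {..r} - {i}" by auto
    have "g ` (verts G' - {v i}) = {..r} - {i}"
      using g(1) v[OF i] by (auto simp: bij_betw_def inj_on_def)
    then have "e = verts G' - {v i}"
      using e sub(1)[OF e(1)] g(1) inj_on_image_eq_iff[of g "verts G'" e "verts G' - {v i}"]
      by (auto simp: bij_betw_def)
    then show ?thesis using sub(2)[OF e(1)] by simp
  qed
  have "v i \<noteq> v j" if "i \<noteq> j" "i \<le> r" "j \<le> r" for i j using v(2) that by metis
  then show False
    using spread_deletions[OF fin, of "v 0" "v 1" "v 2" f] sp[of 0] sp[of 1] sp[of 2] v(1)[of 0] v(1)[of 1] v(1)[of 2] assms(2)
    by (auto)
qed

section \<open>Existence of the Turan density\<close>

lemma card_filter_eq_sum: "finite A \<Longrightarrow> card {x \<in> A. P x} = (\<Sum>x\<in>A. if P x then 1 else 0)"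
  by (simp flip: sum.inter_filter)

text \<open>Makes the \<open>Max\<close> in \<open>ex_num\<close> meaningful; the edgeless
  hypergraph is the witness for nonemptiness.\<close>

lemma ex_num_set:
  fixes H :: "'b hypergraph"
  defines "S n r \<equiv> {card (edges G) | G :: nat hypergraph.
            uniform_hypergraph r G \<and> verts G = {..<n} \<and> \<not> contains_copy G H}"
  shows "finite (S n r)" and "edges H \<noteq> {} \<Longrightarrow> S n r \<noteq> {}"
proof -
  have "S n r \<subseteq> {..card (Pow {..<n})}"
    by (auto simp: S_def uniform_hypergraph_def intro!: card_mono)
  then show "finite (S n r)" by (rule finite_subset) simp
next
  assume H: "edges H \<noteq> {}"
  have "\<not> contains_copy ({..<n}, {}) H"
    using H by (auto simp: contains_copy_def subhypergraph_def hypergraph_iso_def)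
  then have "card (edges ({..<n}, {} :: nat set set)) \<in> S n r"
    unfolding S_def uniform_hypergraph_def by force
  then show "S n r \<noteq> {}" by blast
qed

lemma ex_num_attained:
  assumes "edges H \<noteq> {}"
  obtains G :: "nat hypergraph" where "uniform_hypergraph r G" "verts G = {..<n}"
    "\<not> contains_copy G H" "card (edges G) = ex_num r n H"
  using Max_in[OF ex_num_set(1) ex_num_set(2)[OF assms], of r n] that
  unfolding ex_num_def by auto

text \<open>A copy in the relabelled hypergraph is pulled back along \<open>\<phi>\<close>. Since
  \<open>ex_num\<close> only ranges over the vertex set \<open>{..<n}\<close>, this lets it bound
  hypergraphs on arbitrary vertex sets.\<close>

lemma contains_copy_image:
  assumes inj: "inj_on \<phi> (verts G)" and uni: "uniform_hypergraph r G"
    and copy: "contains_copy (\<phi> ` verts G, (\<lambda>e. \<phi> ` e) ` edges G) H"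
  shows "contains_copy G H"
proof -
  obtain G2 f where G2: "subhypergraph G2 (\<phi> ` verts G, (\<lambda>e. \<phi> ` e) ` edges G)"
    and f: "bij_betw f (verts G2) (verts H)" "edges H = (\<lambda>e. f ` e) ` edges G2"
    using copy by (auto simp: contains_copy_def hypergraph_iso_def)
  have E: "e \<subseteq> verts G" if "e \<in> edges G" for e using that uni by (auto simp: uniform_hypergraph_def)
  define W where "W = {v \<in> verts G. \<phi> v \<in> verts G2}"
  define D where "D = {e \<in> edges G. \<phi> ` e \<in> edges G2}"
  have W: "\<phi> ` W = verts G2" and D: "(\<lambda>e. \<phi> ` e) ` D = edges G2"
    using G2 by (auto simp: W_def D_def subhypergraph_def)
  have "bij_betw \<phi> W (verts G2)"
    using inj W by (auto simp: bij_betw_def W_def intro: inj_on_subset)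
  then have "bij_betw (f \<circ> \<phi>) W (verts H)" using f(1) by (rule bij_betw_trans)
  moreover have "edges H = (\<lambda>e. (f \<circ> \<phi>) ` e) ` D"
    unfolding f(2) D[symmetric] by (simp add: image_image image_comp)
  moreover have "subhypergraph (W, D) G"
    using G2 E by (fastforce simp: subhypergraph_def W_def D_def)
  ultimately show ?thesis unfolding contains_copy_def hypergraph_iso_def by force
qed

lemma ex_num_ge:
  fixes G :: "'a hypergraph"
  assumes uni: "uniform_hypergraph r G" and free: "\<not> contains_copy G H"
  shows "card (edges G) \<le> ex_num r (card (verts G)) H"
proof -
  let ?n = "card (verts G)"
  have fin: "finite (verts G)" and E: "\<And>e. e \<in> edges G \<Longrightarrow> e \<subseteq> verts G"
    using uni by (auto simp: uniform_hypergraph_def)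
  obtain \<phi> where \<phi>: "bij_betw \<phi> (verts G) {..<?n}"
    using ex_bij_betw_finite_nat[OF fin] by (auto simp: atLeast0LessThan)
  then have inj: "inj_on \<phi> (verts G)" by (simp add: bij_betw_def)
  define G2 where "G2 = (\<phi> ` verts G, (\<lambda>e. \<phi> ` e) ` edges G)"
  have "verts G2 = {..<?n}" using \<phi> by (simp add: G2_def bij_betw_def)
  moreover have "uniform_hypergraph r G2"
    using uni E by (auto simp: uniform_hypergraph_def G2_def card_image[OF inj_on_subset[OF inj]])
  moreover have "\<not> contains_copy G2 H"
    using contains_copy_image[OF inj uni, of H] free unfolding G2_def by blast
  moreover have "card (edges G2) = card (edges G)"
    unfolding G2_def snd_conv
    by (rule card_image, rule inj_onI) (metis E inj inj_on_image_eq_iff)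
  ultimately show ?thesis
    unfolding ex_num_def by (intro Max_ge ex_num_set(1) CollectI exI[of _ G2]) simp
qed

text \<open>Averaging over vertex deletions: each edge of an extremal hypergraph on
  \<open>Suc n\<close> vertices survives exactly \<open>Suc n - r\<close> of the deletions, and each
  deletion leaves an \<open>H\<close>-free hypergraph on \<open>n\<close> vertices.\<close>

lemma ex_num_Suc:
  assumes H: "edges H \<noteq> {}" and r: "r \<le> Suc n"
  shows "(Suc n - r) * ex_num r (Suc n) H \<le> Suc n * ex_num r n H"
proof -
  obtain G :: "nat hypergraph" where uni: "uniform_hypergraph r G" and V: "verts G = {..<Suc n}"
    and free: "\<not> contains_copy G H" and card: "card (edges G) = ex_num r (Suc n) H"
    using ex_num_attained[OF H] by blast
  have finE: "finite (edges G)"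
    using uni V by (intro finite_subset[of "edges G" "Pow {..<Suc n}"]) (auto simp: uniform_hypergraph_def)
  define D where "D v = {e \<in> edges G. v \<notin> e}" for v
  have D: "card (D v) \<le> ex_num r n H" if v: "v < Suc n" for v
  proof -
    have "uniform_hypergraph r ({..<Suc n} - {v}, D v)"
      using uni V by (auto simp: uniform_hypergraph_def D_def)
    moreover have "\<not> contains_copy ({..<Suc n} - {v}, D v) H"
    proof
      assume "contains_copy ({..<Suc n} - {v}, D v) H"
      then obtain G' where "subhypergraph G' ({..<Suc n} - {v}, D v)" "hypergraph_iso G' H"
        by (auto simp: contains_copy_def)
      moreover from this have "subhypergraph G' G" by (auto simp: subhypergraph_def V D_def)
      ultimately show False using free unfolding contains_copy_def by blast
    qed
    ultimately show ?thesis using ex_num_ge[of r "({..<Suc n} - {v}, D v)" H] v by simp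
  qed
  have "(\<Sum>v<Suc n. card (D v)) = (\<Sum>v<Suc n. \<Sum>e\<in>edges G. if v \<notin> e then 1 else 0)"
    unfolding D_def card_filter_eq_sum[OF finE] ..
  also have "\<dots> = (\<Sum>e\<in>edges G. \<Sum>v<Suc n. if v \<notin> e then 1 else 0)"
    by (rule sum.swap)
  also have "\<dots> = (\<Sum>e\<in>edges G. Suc n - r)"
  proof (rule sum.cong[OF refl])
    fix e assume "e \<in> edges G"
    then have e: "e \<subseteq> {..<Suc n}" "card e = r" using uni V by (auto simp: uniform_hypergraph_def)
    have "(\<Sum>v<Suc n. if v \<notin> e then 1 else 0) = card ({..<Suc n} - e)"
      unfolding set_diff_eq by (rule card_filter_eq_sum[symmetric]) simp
    also have "\<dots> = Suc n - r" using e by (simp add: card_Diff_subset finite_subset)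
    finally show "(\<Sum>v<Suc n. if v \<notin> e then 1 else 0) = Suc n - r" .
  qed
  finally have "(Suc n - r) * ex_num r (Suc n) H = (\<Sum>v<Suc n. card (D v))" by (simp add: card)
  also have "\<dots> \<le> (\<Sum>v<Suc n. ex_num r n H)" using D by (intro sum_mono) auto
  finally show ?thesis by simp
qed

lemma turan_density_tendsto:
  assumes H: "edges H \<noteq> {}"
  shows "(\<lambda>n. real (ex_num r n H) / real (n choose r)) \<longlonglongrightarrow> turan_density r H"
proof -
  let ?d = "\<lambda>n. real (ex_num r n H) / real (n choose r)"
  \<comment> \<open>The shift by \<open>r\<close> avoids the indices below \<open>r\<close>, where
    the binomial coefficient is 0 and the quotient is 0 by convention.\<close>
  have "decseq (\<lambda>k. ?d (k + r))"
  proof (rule decseq_SucI)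
    fix k
    let ?n = "k + r"
    have pos: "real (?n choose r) > 0" "real (Suc ?n choose r) > 0" by (simp_all add: zero_less_binomial)
    have "(Suc ?n - r) * (Suc ?n choose r) = Suc ?n * (?n choose r)"
      using binomial_absorb_comp[of "Suc ?n" r] by simp
    then have B: "real (Suc k) * real (Suc ?n choose r) = real (Suc ?n) * real (?n choose r)"
      by (metis of_nat_mult add_Suc add_diff_cancel_right')
    have "Suc k * ex_num r (Suc ?n) H \<le> Suc ?n * ex_num r ?n H"
      using ex_num_Suc[OF H, of r ?n] by (simp add: Suc_diff_le)
    then have A: "real (Suc k) * real (ex_num r (Suc ?n) H) \<le> real (Suc ?n) * real (ex_num r ?n H)"
      by (simp only: of_nat_mult[symmetric] of_nat_le_iff)
    have "real (Suc k) * (real (ex_num r (Suc ?n) H) * real (?n choose r))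
      \<le> real (Suc ?n) * real (ex_num r ?n H) * real (?n choose r)"
      using mult_right_mono[OF A, of "real (?n choose r)"] by (simp add: mult.assoc)
    also have "\<dots> = real (Suc k) * (real (ex_num r ?n H) * real (Suc ?n choose r))"
      using arg_cong[OF B, of "\<lambda>z. z * real (ex_num r ?n H)"] by (simp only: mult_ac)
    finally have "real (ex_num r (Suc ?n) H) * real (?n choose r)
      \<le> real (ex_num r ?n H) * real (Suc ?n choose r)"
      by (rule mult_left_le_imp_le) simp
    then show "?d (Suc k + r) \<le> ?d (k + r)" using pos by (simp add: field_simps)
  qed
  then have "convergent (\<lambda>k. ?d (k + r))"
    by (intro Bseq_monoseq_convergent decseq_imp_monoseq decseq_bounded[of _ 0]) auto
  then have "convergent ?d"
    by (auto simp: convergent_def dest: LIMSEQ_offset)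
  then show ?thesis by (simp add: turan_density_def convergent_LIMSEQ_iff)
qed

section \<open>Counting labellings\<close>

text \<open>A labelling of \<open>V\<close> is a pair of labellings of \<open>e\<close> and of
  \<open>V - e\<close>, and the second one is unconstrained.\<close>

lemma card_PiE_restrict:
  assumes V: "finite V" "e \<subseteq> V"
  shows "card {f \<in> V \<rightarrow>\<^sub>E B. P (restrict f e)} = card {g \<in> e \<rightarrow>\<^sub>E B. P g} * card B ^ (card V - card e)"
proof -
  have "bij_betw (\<lambda>f. (restrict f e, restrict f (V - e))) {f \<in> V \<rightarrow>\<^sub>E B. P (restrict f e)}
      ({g \<in> e \<rightarrow>\<^sub>E B. P g} \<times> (V - e \<rightarrow>\<^sub>E B))"
  proof (rule bij_betwI[where g = "\<lambda>(g, h). \<lambda>v\<in>V. if v \<in> e then g v else h v"], goal_cases)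
    case 1
    show ?case using V(2) by (auto simp: PiE_iff split: if_splits)
  next
    case 2
    have "restrict (\<lambda>v\<in>V. if v \<in> e then g v else h v) e = g" if "g \<in> e \<rightarrow>\<^sub>E B" for g h :: "'a \<Rightarrow> 'b"
      using that V(2) by (auto simp: fun_eq_iff PiE_iff extensional_def)
    then show ?case by (auto simp: PiE_iff)
  next
    case (3 f)
    then show ?case by (auto simp: fun_eq_iff PiE_iff extensional_def)
  next
    case (4 p)
    then show ?case using V(2)
      by (cases p) (auto simp: fun_eq_iff PiE_iff extensional_def)
  qed
  then have "card {f \<in> V \<rightarrow>\<^sub>E B. P (restrict f e)} = card {g \<in> e \<rightarrow>\<^sub>E B. P g} * card (V - e \<rightarrow>\<^sub>E B)"
    by (simp add: bij_betw_same_card card_cartesian_product)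
  then show ?thesis
    using V by (simp add: card_PiE card_Diff_subset finite_subset)
qed

text \<open>\<open>XOR\<close> with \<open>c\<close> is injective and maps this ball into
  \<open>{..s}\<close>.\<close>

lemma
  shows finite_xor_le: "finite {b. b XOR c \<le> (s::nat)}"
    and card_xor_le: "card {b. b XOR c \<le> (s::nat)} \<le> Suc s"
proof -
  have inj: "inj_on (\<lambda>b. b XOR c) {b. b XOR c \<le> s}"
    by (rule inj_onI) (metis xor.commute xor_self_left)
  have sub: "(\<lambda>b. b XOR c) ` {b. b XOR c \<le> s} \<subseteq> {..s}" by auto
  show "finite {b. b XOR c \<le> s}" by (rule inj_on_finite[OF inj sub]) simp
  show "card {b. b XOR c \<le> s} \<le> Suc s" using card_inj_on_le[OF inj sub] by simp
qed

definition separated :: "nat \<Rightarrow> 'a set \<Rightarrow> nat \<Rightarrow> ('a \<Rightarrow> nat) set" where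
  "separated N T s = {g \<in> T \<rightarrow>\<^sub>E {..<N}. \<forall>a\<in>T. \<forall>b\<in>T. a \<noteq> b \<longrightarrow> s < g a XOR g b}"

text \<open>If a further vertex gets the label \<open>s XOR xor_sum.F g T\<close>, its
  \<open>XOR\<close> with \<open>g a\<close> is \<open>s XOR xor_sum.F g (T - {a})\<close>. So these
  are the labellings for which the further vertex comes too close to some \<open>a\<close>.\<close>

definition clashing :: "nat \<Rightarrow> 'a set \<Rightarrow> nat \<Rightarrow> ('a \<Rightarrow> nat) set" where
  "clashing N T s = {g \<in> T \<rightarrow>\<^sub>E {..<N}. \<exists>a\<in>T. s XOR xor_sum.F g (T - {a}) \<le> s}"

lemma finite_separated: "finite T \<Longrightarrow> finite (separated N T s)"
  and finite_clashing: "finite T \<Longrightarrow> finite (clashing N T s)"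
  unfolding separated_def clashing_def by (simp_all add: finite_PiE)

text \<open>Greedy labelling: each vertex already labelled blocks at most \<open>Suc s\<close>
  labels for the next one. Truncated subtraction makes the bound trivial when the blocked labels
  might exhaust all \<open>N\<close>.\<close>

lemma card_separated_ge:
  assumes "finite T"
  shows "(\<Prod>j<card T. N - j * Suc s) \<le> card (separated N T s)"
  using assms
proof (induction T rule: finite_induct)
  case empty
  then show ?case by (simp add: separated_def)
next
  case (insert z T)
  define Y where "Y g = {y \<in> {..<N}. \<forall>b\<in>T. s < y XOR g b}" for g
  have Y: "N - card T * Suc s \<le> card (Y g)" for g
  proof -
    have "card (\<Union>b\<in>T. {y. y XOR g b \<le> s}) \<le> (\<Sum>b\<in>T. card {y. y XOR g b \<le> s})"
      by (rule card_UN_le[OF insert(1)])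
    also have "\<dots> \<le> card T * Suc s"
      using sum_bounded_above[of T "\<lambda>b. card {y. y XOR g b \<le> s}" "Suc s"] card_xor_le by simp
    finally have "N - card T * Suc s \<le> card {..<N} - card (\<Union>b\<in>T. {y. y XOR g b \<le> s})" by simp
    also have "\<dots> \<le> card ({..<N} - (\<Union>b\<in>T. {y. y XOR g b \<le> s}))"
      using insert(1) by (intro diff_card_le_card_Diff) (simp add: finite_xor_le)
    also have "{..<N} - (\<Union>b\<in>T. {y. y XOR g b \<le> s}) = Y g" by (auto simp: Y_def not_le)
    finally show ?thesis .
  qed
  have finY: "finite (Y g)" for g by (simp add: Y_def)
  let ?\<Phi> = "\<lambda>(g, y). g(z := y)"
  have "(\<Prod>j<card (insert z T). N - j * Suc s) = (\<Prod>j<card T. N - j * Suc s) * (N - card T * Suc s)"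
    using insert by simp
  also have "\<dots> \<le> card (separated N T s) * (N - card T * Suc s)"
    using insert by (intro mult_right_mono) auto
  also have "\<dots> = (\<Sum>g\<in>separated N T s. N - card T * Suc s)" by simp
  also have "\<dots> \<le> (\<Sum>g\<in>separated N T s. card (Y g))" by (intro sum_mono Y)
  also have "\<dots> = card (Sigma (separated N T s) Y)"
    using insert finY by (simp add: finite_separated)
  also have "\<dots> \<le> card (separated N (insert z T) s)"
  proof (rule card_inj_on_le[where f = ?\<Phi>])
    show "finite (separated N (insert z T) s)" using insert by (simp add: finite_separated)
    show "inj_on ?\<Phi> (Sigma (separated N T s) Y)"
    proof (rule inj_onI, clarify)
      fix g y g' y'
      assume g: "g \<in> separated N T s" "g' \<in> separated N T s" and eq: "g(z := y) = g'(z := y')"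
      have "g z = g' z" using g insert(2) by (auto simp: separated_def PiE_iff extensional_def)
      then show "g = g' \<and> y = y'" using eq by (metis fun_upd_same fun_upd_triv fun_upd_upd)
    qed
    show "?\<Phi> ` Sigma (separated N T s) Y \<subseteq> separated N (insert z T) s"
      using insert(2) by (auto simp: separated_def Y_def xor.commute PiE_iff extensional_def)
  qed
  finally show ?case .
qed

text \<open>Union bound over \<open>a\<close>. For fixed \<open>a\<close>, pick another vertex
  \<open>b\<close>; the label of \<open>b\<close> is recovered from the labels off \<open>b\<close>
  and the value of the \<open>XOR\<close>, which has at most \<open>Suc s\<close>
  possibilities.\<close>

lemma card_clashing_le:
  assumes T: "finite T" "card T \<ge> 2"
  shows "card (clashing N T s) \<le> card T * (Suc s * N ^ (card T - 1))"
proof -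
  define C where "C a = {g \<in> T \<rightarrow>\<^sub>E {..<N}. s XOR xor_sum.F g (T - {a}) \<le> s}" for a
  have C: "card (C a) \<le> Suc s * N ^ (card T - 1)" if a: "a \<in> T" for a
  proof -
    have "T - {a} \<noteq> {}" using T a card_Diff_singleton[of a T] by force
    then obtain b where b: "b \<in> T" "b \<noteq> a" by blast
    let ?\<Phi> = "\<lambda>g. (s XOR xor_sum.F g (T - {a}), restrict g (T - {b}))"
    have "card (C a) \<le> card ({..s} \<times> (T - {b} \<rightarrow>\<^sub>E {..<N}))"
    proof (rule card_inj_on_le[where f = ?\<Phi>])
      show "finite ({..s} \<times> (T - {b} \<rightarrow>\<^sub>E {..<N}))" using T by (simp add: finite_PiE)
      show "?\<Phi> ` C a \<subseteq> {..s} \<times> (T - {b} \<rightarrow>\<^sub>E {..<N})"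
        by (auto simp: C_def PiE_iff split: if_splits)
      show "inj_on ?\<Phi> (C a)"
      proof (rule inj_onI)
        fix g h assume g: "g \<in> C a" "h \<in> C a" and eq: "?\<Phi> g = ?\<Phi> h"
        then have eq': "g v = h v" if "v \<in> T - {b}" for v
          using that by (metis prod.inject restrict_apply')
        have rem: "xor_sum.F f (T - {a}) = f b XOR xor_sum.F f (T - {a} - {b})" for f
          using b T(1) by (intro xor_sum.remove) auto
        have rest: "xor_sum.F g (T - {a} - {b}) = xor_sum.F h (T - {a} - {b})"
          using eq' by (intro xor_sum.cong) auto
        have "xor_sum.F g (T - {a}) = xor_sum.F h (T - {a})"
          using eq by (metis prod.inject xor_self_left)
        then have "g b = h b" unfolding rem rest by (metis xor.commute xor_self_left)
        then show "g = h" using g eq' by (auto simp: C_def PiE_iff intro!: extensionalityI[of g T h])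
      qed
    qed
    also have "\<dots> = Suc s * N ^ (card T - 1)"
      using T b by (simp add: card_cartesian_product card_PiE)
    finally show ?thesis .
  qed
  have "clashing N T s = (\<Union>a\<in>T. C a)" by (auto simp: clashing_def C_def)
  also have "card \<dots> \<le> (\<Sum>a\<in>T. card (C a))" using T by (intro card_UN_le)
  also have "\<dots> \<le> card T * (Suc s * N ^ (card T - 1))"
    using sum_bounded_above[of T "\<lambda>a. card (C a)", OF C] by simp
  finally show ?thesis .
qed

text \<open>Prescribing the sum \<open>s\<close> determines the label of the last vertex \<open>z\<close> from the labels on the
  rest \<open>T\<close>; the pairs inside \<open>T\<close> are then controlled by \<open>separated\<close>, those containing \<open>z\<close>
  by \<open>clashing\<close>.\<close>

lemma card_spread_ge:
  assumes e: "finite e" "card e = Suc m" "m \<ge> 2" and M: "M \<le> 2 ^ k"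
  shows "(\<Sum>s<M. real (\<Prod>j<m. 2 ^ k - j * Suc s) - real (m * (Suc s * (2 ^ k) ^ (m - 1))))
    \<le> real (card {f \<in> e \<rightarrow>\<^sub>E {..<2 ^ k}. spread f e})"
proof -
  let ?N = "2 ^ k :: nat"
  obtain z T where z: "e = insert z T" "z \<notin> T" using e by (metis card_eq_SucD)
  have T: "finite T" "card T = m" using z e by auto
  let ?D = "\<lambda>s. separated ?N T s - clashing ?N T s"
  let ?\<Phi> = "\<lambda>(s, g). g(z := s XOR xor_sum.F g T)"
  have sum: "xor_sum.F (g(z := y)) e = y XOR xor_sum.F g T" for g y
  proof -
    have "xor_sum.F (g(z := y)) T = xor_sum.F g T" using z(2) by (intro xor_sum.cong) auto
    then show ?thesis using z T(1) by (simp add: xor_sum.insert)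
  qed
  have bound: "xor_sum.F g S < ?N" if "finite S" "\<And>v. v \<in> S \<Longrightarrow> g v < ?N" for g and S :: "'a set"
    using that by (induction S rule: finite_induct) (auto intro: xor_less_power2)
  have "(\<Sum>s<M. real (\<Prod>j<m. ?N - j * Suc s) - real (m * (Suc s * ?N ^ (m - 1))))
    \<le> (\<Sum>s<M. real (card (?D s)))"
  proof (rule sum_mono)
    fix s
    have "card (separated ?N T s) - card (clashing ?N T s) \<le> card (?D s)"
      by (rule diff_card_le_card_Diff) (simp add: finite_clashing T)
    moreover have "(\<Prod>j<m. ?N - j * Suc s) \<le> card (separated ?N T s)"
      using card_separated_ge[OF T(1), of ?N s] T by simp
    moreover have "card (clashing ?N T s) \<le> m * (Suc s * ?N ^ (m - 1))"
      using card_clashing_le[OF T(1), of ?N s] T e by simp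
    ultimately have "(\<Prod>j<m. ?N - j * Suc s) \<le> card (?D s) + m * (Suc s * ?N ^ (m - 1))" by linarith
    then show "real (\<Prod>j<m. ?N - j * Suc s) - real (m * (Suc s * ?N ^ (m - 1))) \<le> real (card (?D s))"
      by (simp only: of_nat_le_iff of_nat_add[symmetric] diff_le_eq)
  qed
  also have "\<dots> = real (card (SIGMA s:{..<M}. ?D s))"
    using T by (subst card_SigmaI) (auto simp: finite_separated)
  also have "card (SIGMA s:{..<M}. ?D s) \<le> card {f \<in> e \<rightarrow>\<^sub>E {..<?N}. spread f e}"
  proof (rule card_inj_on_le[where f = ?\<Phi>])
    show "finite {f \<in> e \<rightarrow>\<^sub>E {..<?N}. spread f e}" using e by (simp add: finite_PiE)
    \<comment> \<open>\<open>g\<close> is undefined outside \<open>T\<close>, so the values on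
      \<open>T\<close> determine it; the label of \<open>z\<close> then gives back
      \<open>s\<close>.\<close>
    show "inj_on ?\<Phi> (SIGMA s:{..<M}. ?D s)"
    proof (rule inj_onI, clarify)
      fix s g s' g'
      assume g: "g \<in> separated ?N T s" "g' \<in> separated ?N T s'"
        and eq: "g(z := s XOR xor_sum.F g T) = g'(z := s' XOR xor_sum.F g' T)"
      have "g z = g' z" using g z by (auto simp: separated_def PiE_iff extensional_def)
      then have gg: "g = g'" using eq by (metis fun_upd_triv fun_upd_upd)
      then have "s XOR xor_sum.F g T = s' XOR xor_sum.F g T" using eq by (metis fun_upd_same)
      then show "s = s' \<and> g = g'" using gg by (metis xor.commute xor_self_left)
    qed
    show "?\<Phi> ` (SIGMA s:{..<M}. ?D s) \<subseteq> {f \<in> e \<rightarrow>\<^sub>E {..<?N}. spread f e}"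
    proof clarify
      fix s g assume s: "s < M" and g: "g \<in> separated ?N T s" "g \<notin> clashing ?N T s"
      let ?f = "g(z := s XOR xor_sum.F g T)"
      have gN: "g v < ?N" if "v \<in> T" for v using g that by (auto simp: separated_def PiE_iff)
      \<comment> \<open>\<open>M \<le> 2 ^ k\<close> makes \<open>s\<close> itself a label, so the
        label of \<open>z\<close> stays in range.\<close>
      have "s XOR xor_sum.F g T < ?N"
        using s M gN by (intro xor_less_power2 bound T) auto
      then have mem: "?f \<in> e \<rightarrow>\<^sub>E {..<?N}"
        using g z by (auto simp: separated_def PiE_iff extensional_def)
      have Fs: "xor_sum.F ?f e = s"
        unfolding sum by (metis xor.commute xor_self_left)
      have far: "s < ?f z XOR ?f a" if "a \<in> T" for a
      proof -
        have cancel: "(s XOR (u XOR w)) XOR u = s XOR w" for u w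
          by (simp add: xor_self_left ac_simps)
        have "?f z XOR ?f a = (s XOR xor_sum.F g T) XOR g a"
          using that z(2) by auto
        also have "\<dots> = s XOR xor_sum.F g (T - {a})"
          using xor_sum.remove[OF T(1) that, of g] cancel by simp
        finally have "?f z XOR ?f a = s XOR xor_sum.F g (T - {a})" .
        then show ?thesis using g that by (auto simp: separated_def clashing_def not_le)
      qed
      have "s < ?f a XOR ?f b" if "a \<in> e" "b \<in> e" "a \<noteq> b" for a b
      proof (cases "a = z \<or> b = z")
        case True
        then show ?thesis using far[of a] far[of b] that z by (auto simp: xor.commute)
      next
        case False
        then show ?thesis using g(1) that z by (auto simp: separated_def)
      qed
      then show "?f \<in> e \<rightarrow>\<^sub>E {..<?N} \<and> spread ?f e"
        using mem unfolding spread_def Fs by blast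
    qed
  qed
  finally show ?thesis by simp
qed

text \<open>Averaging over all labellings of the \<open>n\<close> vertices.\<close>

lemma ex_num_H3_ge:
  assumes r: "r \<ge> 2" and N: "N > 0"
    and q: "\<And>e :: nat set. finite e \<Longrightarrow> card e = r \<Longrightarrow> q \<le> real (card {f \<in> e \<rightarrow>\<^sub>E {..<N}. spread f e})"
  shows "q * real (n choose r) \<le> real (ex_num r n (H3 r)) * real N ^ r"
proof (cases "r \<le> n")
  case False
  then show ?thesis by (simp add: binomial_eq_0)
next
  case True
  let ?V = "{..<n}" and ?\<Omega> = "{..<n} \<rightarrow>\<^sub>E {..<N}"
  let ?E = "{e. e \<subseteq> ?V \<and> card e = r}"
  have fin: "finite ?\<Omega>" "finite ?E" by (simp_all add: finite_PiE)
  have "q * real (n choose r) * real N ^ (n - r) = (\<Sum>e\<in>?E. q * real N ^ (n - r))"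
    by (simp add: n_subsets)
  also have "\<dots> \<le> (\<Sum>e\<in>?E. real (card {f \<in> ?\<Omega>. spread f e}))"
  proof (rule sum_mono, clarify)
    fix e :: "nat set" assume e: "e \<subseteq> ?V" "r = card e"
    have "spread (restrict f e) e = spread f e" for f :: "nat \<Rightarrow> nat" by (rule spread_cong) simp
    then have "card {f \<in> ?\<Omega>. spread f e} = card {f \<in> e \<rightarrow>\<^sub>E {..<N}. spread f e} * N ^ (n - card e)"
      using card_PiE_restrict[of ?V e "{..<N}" "\<lambda>f. spread f e"] e by simp
    then show "q * real N ^ (n - card e) \<le> real (card {f \<in> ?\<Omega>. spread f e})"
      using q[of e] e by (simp add: mult_right_mono finite_subset)
  qed
  also have "\<dots> = real (\<Sum>e\<in>?E. \<Sum>f\<in>?\<Omega>. if spread f e then 1 else 0)"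
    unfolding card_filter_eq_sum[OF fin(1)] by simp
  also have "\<dots> = real (\<Sum>f\<in>?\<Omega>. \<Sum>e\<in>?E. if spread f e then 1 else 0)"
    by (subst sum.swap) (rule refl)
  also have "\<dots> \<le> real (\<Sum>f\<in>?\<Omega>. ex_num r n (H3 r))"
  proof (intro of_nat_mono sum_mono)
    fix f
    have "(\<Sum>e\<in>?E. if spread f e then 1 else 0) = card (edges (spread_hypergraph r ?V f))"
      by (simp add: spread_hypergraph_def card_filter_eq_sum[OF fin(2), symmetric] conj_assoc)
    also have "\<dots> \<le> ex_num r n (H3 r)"
      using ex_num_ge[OF uniform_spread_hypergraph spread_hypergraph_H3_free[OF _ r], of ?V f]
      by (simp add: spread_hypergraph_def)
    finally show "(\<Sum>e\<in>?E. if spread f e then 1 else 0) \<le> ex_num r n (H3 r)" .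
  qed
  also have "\<dots> = real (ex_num r n (H3 r)) * real N ^ r * real N ^ (n - r)"
    using True by (simp add: card_PiE power_add[symmetric])
  finally show ?thesis using N by simp
qed

text \<open>The averaged bound on the edge density does not depend on \<open>n\<close>, so it passes
  to the limit.\<close>

lemma turan_density_H3_ge:
  assumes r: "r \<ge> 2" and N: "N > 0"
    and q: "\<And>e :: nat set. finite e \<Longrightarrow> card e = r \<Longrightarrow> q \<le> real (card {f \<in> e \<rightarrow>\<^sub>E {..<N}. spread f e})"
  shows "q / real N ^ r \<le> turan_density r (H3 r)"
proof (rule LIMSEQ_le_const[OF turan_density_tendsto])
  show "edges (H3 r) \<noteq> {}" by (simp add: H3_def)
  have "q / real N ^ r \<le> real (ex_num r n (H3 r)) / real (n choose r)" if "n \<ge> r" for n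
    using ex_num_H3_ge[OF r N q, of n] N that by (simp add: field_simps)
  then show "\<exists>m. \<forall>n\<ge>m. q / real N ^ r \<le> real (ex_num r n (H3 r)) / real (n choose r)" by blast
qed

section \<open>Asymptotics\<close>

text \<open>With \<open>t i = x / 2 ^ i\<close> the two series are \<open>\<Sum>i\<ge>1. 2 * t i * exp (- t i)\<close> and
  \<open>\<Sum>i\<ge>0. (t i)\<^sup>2 * exp (- t i)\<close>. Since \<open>t (i - 1) = 2 * t i\<close> and \<open>u - u\<^sup>2 / 2 \<le> 1 - exp (- u)\<close>, the difference of
  their \<open>i\<close>-th terms is at most \<open>2 * (exp (- t i) - exp (- t (i - 1)))\<close>, which telescopes.\<close>

lemma F_le_2:
  assumes x: "x > 0"
  shows "F x \<le> 2"
proof -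
  define t where "t i = x / 2 ^ i" for i :: nat
  have t0: "t 0 = x" and t2: "t i = 2 * t (Suc i)" and tp: "t i > 0" for i
    using x by (simp_all add: t_def)
  define A where "A i = 2 * t i * exp (- t i)" for i
  define B where "B i = (t i)\<^sup>2 * exp (- t i)" for i
  have sumt: "summable t"
    using summable_mult[OF summable_geometric[of "1 / 2 :: real"], of x]
    by (simp add: t_def[abs_def] power_one_over)
  have sA: "summable A"
  proof (rule summable_comparison_test')
    show "summable (\<lambda>i. 2 * t i)" using sumt by (rule summable_mult)
    show "norm (A i) \<le> 2 * t i" for i using tp[of i] by (simp add: A_def)
  qed
  have sB: "summable B"
  proof (rule summable_comparison_test')
    show "summable (\<lambda>i. t i)" using sumt .
    show "norm (B i) \<le> t i" for i
    proof -
      have "t i * exp (- t i) \<le> 1"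
        using order_trans[OF _ exp_ge_add_one_self[of "t i"], of "t i"] by (simp add: exp_minus divide_simps)
      then show ?thesis using tp[of i] mult_left_mono[of "t i * exp (- t i)" 1 "t i"]
        by (simp add: B_def power2_eq_square mult.assoc)
    qed
  qed
  have sA': "summable (\<lambda>i. A (Suc i))" and sB': "summable (\<lambda>i. B (Suc i))"
    using sA sB by (simp_all add: summable_Suc_iff)
  have powr2: "2 powr (- real n) = 1 / 2 ^ n" for n
    by (simp add: powr_minus_divide powr_realpow)
  have "2 * x * (\<Sum>j. let i = real (Suc j) in 2 powr (- i) * exp (- (2 powr (- i)) * x)) = (\<Sum>i. A (Suc i))"
  proof -
    show ?thesis
      unfolding Let_def powr2
    proof (subst suminf_mult[symmetric])
      have "(\<lambda>i. A (Suc i) / (2 * x)) = (\<lambda>j. 1 / 2 ^ Suc j * exp (- (1 / 2 ^ Suc j) * x))"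
        using x by (auto simp: A_def t_def)
      then show "summable (\<lambda>j. 1 / 2 ^ Suc j * exp (- (1 / 2 ^ Suc j) * x))"
        using summable_divide[OF sA', of "2 * x"] by simp
    qed (simp add: A_def t_def mult_ac)
  qed
  moreover have "4 * x\<^sup>2 * (\<Sum>j. let i = real (Suc j) in 2 powr (- 2 * i) * exp (- (2 powr (1 - i)) * x)) = (\<Sum>i. B i)"
  proof -
    have *: "2 powr (- 2 * real (Suc j)) = 1 / (2 ^ Suc j)\<^sup>2" "2 powr (1 - real (Suc j)) = 1 / 2 ^ j" for j
    proof -
      have "2 powr (- 2 * real (Suc j)) = 2 powr (- real (2 * Suc j))" by simp
      also have "\<dots> = 1 / 2 ^ (2 * Suc j)"
        by (rule powr2)
      finally show "2 powr (- 2 * real (Suc j)) = 1 / (2 ^ Suc j)\<^sup>2" by (simp add: power_mult[symmetric] mult.commute)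
      have "2 powr (1 - real (Suc j)) = 2 powr (- real j)" by simp
      then show "2 powr (1 - real (Suc j)) = 1 / 2 ^ j"
        by (simp only: powr2)
    qed
    have B: "4 * x\<^sup>2 * (1 / (2 ^ Suc j)\<^sup>2 * exp (- (1 / 2 ^ j) * x)) = B j" for j
      by (simp add: B_def t_def power2_eq_square)
    have "(\<lambda>j. B j / (4 * x\<^sup>2)) = (\<lambda>j. 1 / (2 ^ Suc j)\<^sup>2 * exp (- (1 / 2 ^ j) * x))"
      unfolding B[symmetric] using x by auto
    then have "summable (\<lambda>j. 1 / (2 ^ Suc j)\<^sup>2 * exp (- (1 / 2 ^ j) * x))"
      using summable_divide[OF sB, of "4 * x\<^sup>2"] by simp
    then show ?thesis unfolding Let_def * by (subst suminf_mult[symmetric]) (auto simp only: B)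
  qed
  \<comment> \<open>The first series starts at \<open>A 1\<close>, the second at \<open>B 0\<close>.
    Splitting off \<open>B 0\<close>, which is \<open>x\<^sup>2 * exp (- x)\<close>, aligns
    them.\<close>
  moreover have "(\<Sum>i. B i) = (\<Sum>i. B (Suc i)) + B 0" by (rule suminf_split_head[OF sB, THEN eq_diff_eq[THEN iffD1], symmetric])
  moreover have "(\<Sum>i. A (Suc i)) - (\<Sum>i. B (Suc i)) = (\<Sum>i. A (Suc i) - B (Suc i))"
    by (rule suminf_diff[OF sA' sB'])
  moreover have "(\<Sum>i. A (Suc i) - B (Suc i)) \<le> 2 * (1 - exp (- x))"
  proof (rule suminf_le_const)
    show "summable (\<lambda>i. A (Suc i) - B (Suc i))" using sA' sB' by (rule summable_diff)
    fix n
    have "A (Suc i) - B (Suc i) \<le> 2 * (exp (- t (Suc i)) - exp (- t i))" for i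
    proof -
      let ?u = "t (Suc i)"
      have "exp (- ?u) \<le> 1 - ?u + ?u\<^sup>2 / 2"
      proof -
        \<comment> \<open>The quadratic Taylor polynomials of \<open>exp u\<close> and
          \<open>exp (- u)\<close> multiply to \<open>1 + u ^ 4 / 4\<close>, so the bound for
          \<open>exp (- u)\<close> follows from the one for \<open>exp u\<close>.\<close>
        have "1 \<le> 1 + (?u\<^sup>2)\<^sup>2 / 4" by simp
        also have "\<dots> = (1 + ?u + ?u\<^sup>2 / 2) * (1 - ?u + ?u\<^sup>2 / 2)"
          by (simp add: algebra_simps power2_eq_square)
        also have "\<dots> \<le> exp ?u * (1 - ?u + ?u\<^sup>2 / 2)"
          using sum_power2_ge_zero[of "?u - 1" 1] exp_lower_Taylor_quadratic[of ?u] tp[of "Suc i"]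
          by (intro mult_right_mono) (simp_all add: power2_eq_square algebra_simps)
        finally show ?thesis by (simp add: exp_minus field_simps)
      qed
      then have "2 * exp (- ?u) * (?u - ?u\<^sup>2 / 2) \<le> 2 * exp (- ?u) * (1 - exp (- ?u))"
        by (intro mult_left_mono) auto
      then show ?thesis
        by (simp add: A_def B_def t2[of i] algebra_simps exp_double[symmetric] power2_eq_square exp_add[symmetric])
    qed
    then have "(\<Sum>i<n. A (Suc i) - B (Suc i)) \<le> (\<Sum>i<n. 2 * (exp (- t (Suc i)) - exp (- t i)))"
      by (rule sum_mono)
    also have "\<dots> = 2 * (exp (- t n) - exp (- x))"
      unfolding sum_distrib_left[symmetric] sum_lessThan_telescope[of "\<lambda>i. exp (- t i)" n] t0 ..
    also have "\<dots> \<le> 2 * (1 - exp (- x))" using tp[of n] by simp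
    finally show "(\<Sum>i<n. A (Suc i) - B (Suc i)) \<le> 2 * (1 - exp (- x))" .
  qed
  ultimately have "F x \<le> 2 * x * exp (- x) / (1 - exp (- 2 * x)) + 2 * (1 - exp (- x)) - x\<^sup>2 * exp (- x)"
    unfolding F_def by (simp add: B_def t0)
  \<comment> \<open>The bound so far is 2 plus \<open>2 * exp (- x)\<close> times the difference of
    the two sides here.\<close>
  moreover have "x / (1 - exp (- 2 * x)) \<le> 1 + x\<^sup>2 / 2"
  proof -
    have "1 + 2 * x + (2 * x)\<^sup>2 / 2 \<le> exp (2 * x)" using exp_lower_Taylor_quadratic[of "2 * x"] x by simp
    then have e: "exp (2 * x) - 1 \<ge> 2 * x * (1 + x)" by (simp add: power2_eq_square algebra_simps)
    have "x / (1 - exp (- 2 * x)) = x + x / (exp (2 * x) - 1)"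
      using x by (simp add: exp_minus field_simps)
    also have "x / (exp (2 * x) - 1) \<le> x / (2 * x * (1 + x))"
      using e x by (intro divide_left_mono) (auto intro!: mult_pos_pos)
    also have "x / (2 * x * (1 + x)) = 1 / (2 * (1 + x))" using x by simp
    also have "x + 1 / (2 * (1 + x)) \<le> 1 + x\<^sup>2 / 2"
    proof -
      have "0 \<le> (x - 1)\<^sup>2" by simp
      moreover have "1 / (2 * (1 + x)) \<le> 1 / 2" using x by simp
      ultimately show ?thesis by (simp add: power2_eq_square algebra_simps)
    qed
    finally show ?thesis by simp
  qed
  then have "2 * exp (- x) * (x / (1 - exp (- 2 * x))) \<le> 2 * exp (- x) * (1 + x\<^sup>2 / 2)"
    by (rule mult_left_mono) simp
  ultimately show ?thesis by (simp add: algebra_simps)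
qed

section \<open>Birthday estimate and the limit for large \<open>r\<close>\<close>

lemma exp_le_one_minus:
  fixes u d :: real
  assumes "0 \<le> u" "u \<le> d" "d < 1"
  shows "exp (- (u / (1 - d))) \<le> 1 - u"
proof -
  have "inverse (1 - u) = 1 + u / (1 - u)" using assms by (simp add: field_simps)
  also have "\<dots> \<le> exp (u / (1 - u))" by (rule exp_ge_add_one_self)
  finally have "exp (- (u / (1 - u))) \<le> 1 - u"
    using assms le_imp_inverse_le[of "inverse (1 - u)" "exp (u / (1 - u))"] by (simp add: exp_minus)
  \<comment> \<open>The common denominator \<open>1 - d\<close> makes the exponents of several
    factors add up linearly.\<close>
  moreover have "u / (1 - u) \<le> u / (1 - d)"
    using assms by (intro divide_left_mono) auto
  ultimately show ?thesis by (meson exp_le_cancel_iff neg_le_iff_le order_trans)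
qed

text \<open>Multiply the single-factor bounds; the exponents add up through
  \<open>(\<Sum>j<m. real j) \<le> (real m)\<^sup>2 / 2\<close>. Later \<open>y\<close> is
  \<open>Suc s / N\<close>.\<close>

lemma exp_le_prod_one_minus:
  fixes y d :: real
  assumes y: "0 \<le> y" "real m * y \<le> d" and d: "d < 1"
  shows "exp (- ((real m)\<^sup>2 / 2 * y / (1 - d))) \<le> (\<Prod>j<m. 1 - real j * y)"
proof -
  have sum: "(\<Sum>j<m. real j) \<le> (real m)\<^sup>2 / 2"
    by (induction m) (simp_all add: power2_eq_square algebra_simps)
  have "exp (- ((real m)\<^sup>2 / 2 * y / (1 - d))) \<le> exp (- ((\<Sum>j<m. real j) * (y / (1 - d))))"
    using sum y d mult_right_mono[OF sum, of "y / (1 - d)"] by simp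
  also have "\<dots> = (\<Prod>j<m. exp (- (real j * y / (1 - d))))"
    by (simp add: exp_sum[symmetric] sum_distrib_right sum_divide_distrib sum_negf)
  also have "\<dots> \<le> (\<Prod>j<m. 1 - real j * y)"
  proof (intro prod_mono conjI exp_ge_zero exp_le_one_minus)
    fix j assume "j \<in> {..<m}"
    then have "real j * y \<le> real m * y" using y by (intro mult_right_mono) auto
    then show "real j * y \<le> d" using y(2) by linarith
  qed (use y d in auto)
  finally show ?thesis .
qed

text \<open>Summing the birthday bound over the possible values of the sum \<open>s\<close>, up to \<open>c N / r\<^sup>2\<close>
  with \<open>N = 2 ^ k\<close>, gives a geometric series of ratio \<open>exp (- l / N)\<close>.\<close>

lemma turan_density_H3_ge_approx:
  fixes c :: real
  assumes c: "c > 0" "c < real r" and r: "r \<ge> 3"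
  defines "l \<equiv> (real r)\<^sup>2 / (2 * (1 - c / real r))"
  shows "exp (- (l / 2 ^ k)) * (1 - exp (- c / 2) * exp (l / 2 ^ k)) / l - c\<^sup>2 / real r ^ 3
    \<le> turan_density r (H3 r)"
proof -
  define m where "m = r - 1"
  define N where "N = (2::nat) ^ k"
  \<comment> \<open>For \<open>s\<close> in this range \<open>r * Suc s / N \<le> c / r\<close>,
    which both permits the birthday bound with \<open>d = c / r\<close> and bounds the share of
    clashing labellings by \<open>c / r\<close>.\<close>
  define M where "M = nat \<lfloor>c * real N / (real r)\<^sup>2\<rfloor>"
  define q where "q = (\<Sum>s<M. real (\<Prod>j<m. N - j * Suc s) - real (m * (Suc s * N ^ (m - 1))))"
  have m: "m \<ge> 2" "r = Suc m" using r by (auto simp: m_def)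
  have N0: "real N > 0" by (simp add: N_def)
  have d: "c / real r < 1" "c / real r > 0" using c by auto
  have l0: "l > 0" unfolding l_def using d r by (intro divide_pos_pos mult_pos_pos) auto
  have "real r \<le> (real r)\<^sup>2" using r by (intro self_le_power) auto
  then have "c \<le> (real r)\<^sup>2" using c by linarith
  then have "c * real N \<le> (real r)\<^sup>2 * real N" by (rule mult_right_mono) simp
  then have "c * real N / (real r)\<^sup>2 \<le> real N" using r by (simp add: divide_le_eq mult.commute)
  have Mle: "real M \<le> c * real N / (real r)\<^sup>2" and Mge: "real M \<ge> c * real N / (real r)\<^sup>2 - 1"
    using c(1) by (simp_all add: M_def)
  have MN: "M \<le> N" using Mle \<open>c * real N / (real r)\<^sup>2 \<le> real N\<close> by linarith
  have y: "real r * (real (Suc s) / real N) \<le> c / real r" if "s < M" for s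
  proof -
    have "real (Suc s) \<le> c * real N / (real r)\<^sup>2" using that Mle by linarith
    then show ?thesis using N0 r by (simp add: field_simps power2_eq_square)
  qed
  define z where "z = exp (- (l / real N))"
  have z: "0 < z" "z < 1" using l0 N0 by (auto simp: z_def)
  have summand: "z ^ Suc s - c / real r
      \<le> (real (\<Prod>j<m. N - j * Suc s) - real (m * (Suc s * N ^ (m - 1)))) / real N ^ m" if s: "s < M" for s
  proof -
    let ?y = "real (Suc s) / real N"
    have ym: "real m * ?y \<le> c / real r"
    proof -
      have "real m * ?y \<le> real r * ?y" using m by (intro mult_right_mono) auto
      then show ?thesis using y[OF s] by linarith
    qed
    have "real (\<Prod>j<m. N - j * Suc s) / real N ^ m = (\<Prod>j<m. real (N - j * Suc s) / real N)"
      by (simp add: prod_dividef)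
    also have "\<dots> = (\<Prod>j<m. 1 - real j * ?y)"
    proof (rule prod.cong[OF refl])
      \<comment> \<open>In this range the subtraction on \<open>nat\<close> is not
        truncated.\<close>
      fix j assume "j \<in> {..<m}"
      then have "real j * ?y \<le> real m * ?y" by (intro mult_right_mono) auto
      then have "real j * ?y \<le> 1" using ym d by linarith
      then have "real (j * Suc s) \<le> real N" using N0 by (simp add: field_simps)
      then have "j * Suc s \<le> N" by (simp only: of_nat_le_iff)
      then show "real (N - j * Suc s) / real N = 1 - real j * ?y"
        using N0 by (simp add: of_nat_diff field_simps)
    qed
    finally have "real (\<Prod>j<m. N - j * Suc s) / real N ^ m = (\<Prod>j<m. 1 - real j * ?y)" .
    moreover have "z ^ Suc s \<le> (\<Prod>j<m. 1 - real j * ?y)"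
    proof -
      have "z ^ Suc s = exp (- (l * ?y))"
        by (simp only: z_def exp_of_nat_mult[symmetric]) simp
      also have "\<dots> \<le> exp (- ((real m)\<^sup>2 / 2 * ?y / (1 - c / real r)))"
      proof -
        have "(real m)\<^sup>2 * (?y / (2 * (1 - c / real r))) \<le> (real r)\<^sup>2 * (?y / (2 * (1 - c / real r)))"
        proof (rule mult_right_mono)
          show "(real m)\<^sup>2 \<le> (real r)\<^sup>2" using m by (intro power_mono) auto
          show "0 \<le> ?y / (2 * (1 - c / real r))"
            using d by (intro divide_nonneg_nonneg mult_nonneg_nonneg) auto
        qed
        then show ?thesis unfolding l_def by (simp only: times_divide_eq_left times_divide_eq_right
          divide_divide_eq_left divide_divide_eq_right exp_le_cancel_iff neg_le_iff_le mult_ac)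
      qed
      also have "\<dots> \<le> (\<Prod>j<m. 1 - real j * ?y)"
        by (rule exp_le_prod_one_minus[OF _ ym d(1)]) simp
      finally show ?thesis .
    qed
    moreover have "real (m * (Suc s * N ^ (m - 1))) / real N ^ m = real m * ?y"
    proof -
      have "real N ^ m = real N * real N ^ (m - 1)" using m by (simp flip: power_Suc)
      then show ?thesis using N0 by (simp add: field_simps)
    qed
    ultimately show ?thesis using ym unfolding diff_divide_distrib by linarith
  qed
  have "(1 - z ^ M) * z / l - c\<^sup>2 / real r ^ 3 \<le> (\<Sum>s<M. z ^ Suc s - c / real r) / real N"
  proof -
    \<comment> \<open>This turns the factor \<open>1 / ((1 - z) * N)\<close> of the geometric sum
      into \<open>1 / l\<close>. The \<open>M\<close> error terms \<open>c / r\<close>, divided by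
      \<open>N\<close>, add up to at most \<open>c\<^sup>2 / r ^ 3\<close>.\<close>
    have "1 - z \<le> l / real N" using exp_ge_add_one_self[of "- (l / real N)"] by (simp add: z_def)
    then have "(1 - z) * real N \<le> l" using N0 by (simp add: field_simps)
    then have "(1 - z ^ M) * z / l \<le> (1 - z ^ M) * z / ((1 - z) * real N)"
      using z l0 N0 by (intro divide_left_mono mult_nonneg_nonneg) (auto simp: power_le_one)
    also have "\<dots> = z * (\<Sum>s<M. z ^ s) / real N"
      using z by (simp add: sum_gp_strict)
    also have "z * (\<Sum>s<M. z ^ s) = (\<Sum>s<M. z ^ Suc s)"
      by (simp add: sum_distrib_left)
    finally have A: "(1 - z ^ M) * z / l \<le> (\<Sum>s<M. z ^ Suc s) / real N" .
    have "real M * (c / real r) / real N \<le> c * real N / (real r)\<^sup>2 * (c / real r) / real N"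
      using Mle d N0 by (intro divide_right_mono mult_right_mono) auto
    also have "\<dots> = c\<^sup>2 / real r ^ 3" using N0 by (simp add: power2_eq_square power3_eq_cube)
    finally show ?thesis using A by (simp add: sum_subtractf diff_divide_distrib)
  qed
  also have "\<dots> \<le> (\<Sum>s<M. (real (\<Prod>j<m. N - j * Suc s) - real (m * (Suc s * N ^ (m - 1)))) / real N ^ m) / real N"
    using N0 by (intro divide_right_mono sum_mono summand) auto
  also have "\<dots> = q / real N ^ r"
    using m by (simp add: q_def sum_divide_distrib[symmetric])
  also have "\<dots> \<le> turan_density r (H3 r)"
    using r m N0 MN card_spread_ge[of _ m M k] by (intro turan_density_H3_ge) (auto simp: q_def N_def)
  finally have "(1 - z ^ M) * z / l - c\<^sup>2 / real r ^ 3 \<le> turan_density r (H3 r)" .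
  \<comment> \<open>Rounding in \<open>M\<close> loses at most 1, which costs the factor
    \<open>exp (l / 2 ^ k)\<close>.\<close>
  moreover have "z ^ M \<le> exp (- c / 2) * exp (l / 2 ^ k)"
  proof -
    have "c / 2 \<le> l * (c / (real r)\<^sup>2)"
    proof -
      have "l * (c / (real r)\<^sup>2) = c / 2 / (1 - c / real r)" using r by (simp add: l_def)
      moreover have "c / 2 / 1 \<le> c / 2 / (1 - c / real r)"
        using d c by (intro divide_left_mono mult_pos_pos) auto
      ultimately show ?thesis by simp
    qed
    moreover have "l / real N * (c * real N / (real r)\<^sup>2 - 1) \<le> l / real N * real M"
      using Mge l0 N0 by (intro mult_left_mono) auto
    moreover have "l / real N * (c * real N / (real r)\<^sup>2 - 1) = l * (c / (real r)\<^sup>2) - l / real N"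
      using N0 by (simp add: right_diff_distrib)
    ultimately have "- (real M * (l / real N)) \<le> - c / 2 + l / real N"
      unfolding mult.commute[of "real M"] by linarith
    moreover have "z ^ M = exp (- (real M * (l / real N)))"
      by (simp only: z_def exp_of_nat_mult[symmetric]) simp
    ultimately have "z ^ M \<le> exp (- c / 2 + l / real N)" by simp
    then show ?thesis by (simp only: exp_add) (simp add: N_def)
  qed
  ultimately show ?thesis
    using z l0 mult_right_mono[of "1 - exp (- c / 2) * exp (l / 2 ^ k)" "1 - z ^ M" "z / l"]
    by (simp add: z_def N_def mult.commute)
qed

text \<open>For fixed \<open>r\<close> the preceding bound holds for every \<open>k\<close>; letting
  \<open>k\<close> grow removes the terms \<open>l / 2 ^ k\<close>, and multiplying by
  \<open>r\<^sup>2\<close> gives the claim.\<close>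

lemma turan_density_H3_lower:
  fixes c :: real
  assumes c: "c > 0" "c < real r" and r: "r \<ge> 3"
  shows "2 * (1 - c / real r) * (1 - exp (- c / 2)) - c\<^sup>2 / real r \<le> (real r)\<^sup>2 * turan_density r (H3 r)"
proof -
  define l where "l = (real r)\<^sup>2 / (2 * (1 - c / real r))"
  have l0: "l > 0" unfolding l_def using c by (intro divide_pos_pos mult_pos_pos) auto
  have h: "(\<lambda>k. l / 2 ^ k) \<longlonglongrightarrow> 0"
    using tendsto_mult[OF tendsto_const[of l] LIMSEQ_inverse_realpow_zero[of 2]] by (simp add: divide_inverse)
  have "(\<lambda>k. exp (- (l / 2 ^ k)) * (1 - exp (- c / 2) * exp (l / 2 ^ k)) / l - c\<^sup>2 / real r ^ 3)
      \<longlonglongrightarrow> exp (- 0) * (1 - exp (- c / 2) * exp 0) / l - c\<^sup>2 / real r ^ 3"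
    using l0 by (intro tendsto_intros h) auto
  then have "exp (- 0) * (1 - exp (- c / 2) * exp 0) / l - c\<^sup>2 / real r ^ 3 \<le> turan_density r (H3 r)"
    by (rule LIMSEQ_le_const2) (use turan_density_H3_ge_approx[OF c r] in \<open>auto simp: l_def\<close>)
  then have "(real r)\<^sup>2 * ((1 - exp (- c / 2)) / l - c\<^sup>2 / real r ^ 3) \<le> (real r)\<^sup>2 * turan_density r (H3 r)"
    by (intro mult_left_mono) auto
  moreover have "(real r)\<^sup>2 * ((1 - exp (- c / 2)) / l - c\<^sup>2 / real r ^ 3)
      = 2 * (1 - c / real r) * (1 - exp (- c / 2)) - c\<^sup>2 / real r"
  proof -
    have "(real r)\<^sup>2 / l = 2 * (1 - c / real r)" using c by (simp add: l_def)
    then have "(real r)\<^sup>2 * ((1 - exp (- c / 2)) / l) = 2 * (1 - c / real r) * (1 - exp (- c / 2))"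
      by (metis times_divide_eq_left times_divide_eq_right)
    moreover have "(real r)\<^sup>2 * (c\<^sup>2 / real r ^ 3) = c\<^sup>2 / real r"
      using c by (simp add: power2_eq_square power3_eq_cube)
    ultimately show ?thesis unfolding right_diff_distrib by simp
  qed
  ultimately show ?thesis by simp
qed

theorem theorem14:
  fixes x \<epsilon> :: real
  assumes "x > 0" and "\<epsilon> > 0"
  shows "liminf (\<lambda>r. ereal ((real r)\<^sup>2 * turan_density r (H3 r))) \<ge> ereal (F x - \<epsilon>)"
proof -
  \<comment> \<open>Chosen so that \<open>exp (- c / 2) = \<epsilon> / (2 + \<epsilon>)\<close>;
    cutting the sum off at \<open>c\<close> then costs at most \<open>\<epsilon>\<close> in the
    limit.\<close>
  define c where "c = 2 * ln (2 / \<epsilon> + 1)"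
  have c0: "c > 0" using assms(2) by (auto simp: c_def intro!: ln_gt_zero)
  have "exp (- c / 2) = inverse (2 / \<epsilon> + 1)"
    using assms(2) by (simp add: c_def exp_minus add_pos_pos)
  also have "\<dots> \<le> \<epsilon> / 2" using assms(2) by (simp add: field_simps)
  finally have "F x - \<epsilon> \<le> 2 * (1 - 0) * (1 - exp (- c / 2)) - 0"
    using F_le_2[OF assms(1)] by simp
  let ?g = "\<lambda>r. 2 * (1 - c / real r) * (1 - exp (- c / 2)) - c\<^sup>2 / real r"
  \<comment> \<open>With \<open>c\<close> fixed, all other errors vanish as \<open>r\<close>
    grows.\<close>
  have "?g \<longlonglongrightarrow> 2 * (1 - 0) * (1 - exp (- c / 2)) - 0"
    by (intro tendsto_intros tendsto_divide_0[OF tendsto_const] filterlim_at_top_imp_at_infinity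
        filterlim_real_sequentially)
  then have "liminf (\<lambda>r. ereal (?g r)) = ereal (2 * (1 - 0) * (1 - exp (- c / 2)) - 0)"
    by (intro lim_imp_Liminf) (auto intro: tendsto_ereal)
  with \<open>F x - \<epsilon> \<le> _\<close> have "ereal (F x - \<epsilon>) \<le> liminf (\<lambda>r. ereal (?g r))" by simp
  also have "\<dots> \<le> liminf (\<lambda>r. ereal ((real r)\<^sup>2 * turan_density r (H3 r)))"
  proof (rule Liminf_mono)
    show "\<forall>\<^sub>F r in sequentially. ereal (?g r) \<le> ereal ((real r)\<^sup>2 * turan_density r (H3 r))"
      using eventually_ge_at_top[of 3] eventually_gt_at_top[of "nat \<lceil>c\<rceil>"]
    proof eventually_elim
      case (elim r)
      then have "c < real r" by linarith
      then show ?case using turan_density_H3_lower[OF c0 _ elim(1)] by simp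
    qed
  qed
  finally show ?thesis .
qed

end
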